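(* Let $\sigma\in\mathbb{R}^m$ (stresses of the springs, related to elastic elongations by $\sigma=K\varepsilon$ with $K$ positive diagonal) and let $f\in\mathbb{R}^{nd}$ be a stress load. If the lattice with external displacement constraint matrix $R$ is at equilibrium, i.e. \[ \big(-(D_{\xi_0}\varphi)^T\sigma+f\big)^T\delta\zeta=0\quad\text{for all }\delta\zeta\in\mathrm{Ker}\,R, \] then $(D_{\xi_0}\varphi)^T(-\sigma+Hf)\in\mathrm{Im}\,R^T$. Conversely, if $\mathrm{rank}\begin{pmatrix}(D_{\xi_0}\varphi)^T & R^T\end{pmatrix}=nd$, then for any $f\in\mathbb{R}^{nd}$, $(D_{\xi_0}\varphi)^T(-\sigma+Hf)\in\mathrm{Im}\,R^T$ implies that the lattice is at equilibrium.
   Context: $n,m,d,q$ are positive integers. $Q$ is an $n\times m$ matrix with entries in $\{0,1,-1\}$, each column having exactly one $1$ (origin of spring $i$) and one $-1$ (terminus), other entries $0$. $\xi_0\in\mathbb{R}^{nd}$ lists node coordinates ($\xi^0_{d(j-1)+k}$ is the $k$-th coordinate of node $j$), with the endpoints of each spring distinct. $\varphi:\mathbb{R}^{nd}\to\mathbb{R}^m$, $\varphi_i(\xi)=\sqrt{\sum_{k=1}^d(\sum_{j}Q_{ji}\xi_{d(j-1)+k})^2}$, and $D_{\xi_0}\varphi$ is its $m\times nd$ Jacobian at $\xi_0$: $(D_{\xi_0}\varphi)_{i,d(j-1)+k}=\mathcal{D}_{ik}Q_{ji}$ with $\mathcal{D}_{ik}=\frac{1}{\varphi_i(\xi_0)}\sum_{\bar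 j}Q_{\bar ji}\xi^0_{d(\bar j-1)+k}$. The forces exerted by the springs on the nodes are $-(D_{\xi_0}\varphi)^T\sigma\in\mathbb{R}^{nd}$. $R$ is a $q\times nd$ matrix defining the affine kinematic constraint $R(\zeta+\xi_0)+r(t)=0$ on node displacements $\zeta$. The equilibrium condition above is the principle of virtual work for this constraint. $H$ is the $m\times nd$ matrix formed by the first $m$ rows of the Moore–Penrose pseudoinverse $\begin{pmatrix}(D_{\xi_0}\varphi)^T & R^T\end{pmatrix}^+$ (an $(m+q)\times nd$ matrix). *)

theory Defs
  imports "HOL-Analysis.Analysis"
begin

text \<open>Node coordinates are indexed by pairs (node j, coordinate k); this is the
  index d(j-1)+k of the paper. Springs are indexed by type 's, constraints by 'q.\<close>

definition incidence_matrix :: "real^'s^'node \<Rightarrow> bool" where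
  "incidence_matrix Q \<longleftrightarrow>
     (\<forall>j i. Q $ j $ i \<in> {0, 1, -1}) \<and>
     (\<forall>i. (\<exists>!j. Q $ j $ i = 1) \<and> (\<exists>!j. Q $ j $ i = -1))"

definition spring_length :: "real^'s::finite^'node::finite \<Rightarrow> real^('node \<times> 'dim::finite) \<Rightarrow> 's \<Rightarrow> real" where
  "spring_length Q \<xi> i = sqrt (\<Sum>k\<in>UNIV. (\<Sum>j\<in>UNIV. Q $ j $ i * \<xi> $ (j, k))\<^sup>2)"

definition phi_map :: "real^'s::finite^'node::finite \<Rightarrow> real^('node \<times> 'dim::finite) \<Rightarrow> real^'s" where
  "phi_map Q \<xi> = (\<chi> i. spring_length Q \<xi> i)"

definition Dcal :: "real^'s::finite^'node::finite \<Rightarrow> real^('node \<times> 'dim::finite) \<Rightarrow> 's \<Rightarrow> 'dim \<Rightarrow> real" where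
  "Dcal Q \<xi>0 i k = (1 / spring_length Q \<xi>0 i) * (\<Sum>j\<in>UNIV. Q $ j $ i * \<xi>0 $ (j, k))"

text \<open>Jacobian of phi at xi0, an m x nd matrix.\<close>
definition Dphi :: "real^'s::finite^'node::finite \<Rightarrow> real^('node \<times> 'dim::finite) \<Rightarrow> real^('node \<times> 'dim)^'s" where
  "Dphi Q \<xi>0 = (\<chi> i. \<chi> x. Dcal Q \<xi>0 i (snd x) * Q $ fst x $ i)"

text \<open>Moore--Penrose pseudoinverse, via the four Penrose conditions.\<close>
definition pinv :: "real^'n^'m \<Rightarrow> real^'m^'n" where
  "pinv A = (THE X. A ** X ** A = A \<and> X ** A ** X = X \<and>
                    transpose (A ** X) = A ** X \<and> transpose (X ** A) = X ** A)"

text \<open>The block matrix ( (D phi)^T  R^T ), of size nd x (m+q).\<close>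
definition block_DR :: "real^'N^'s \<Rightarrow> real^'N^'q \<Rightarrow> real^('s + 'q)^'N" where
  "block_DR D R = (\<chi> x. \<chi> c. case c of Inl i \<Rightarrow> D $ i $ x | Inr l \<Rightarrow> R $ l $ x)"

text \<open>H: the first m rows of the pseudoinverse of the block matrix.\<close>
definition Hmat :: "real^'N^'s \<Rightarrow> real^'N^'q \<Rightarrow> real^'N^'s" where
  "Hmat D R = (\<chi> i. pinv (block_DR D R) $ Inl i)"

definition equilibrium :: "real^'N^'s \<Rightarrow> real^'N^'q \<Rightarrow> real^'s \<Rightarrow> real^'N \<Rightarrow> bool" where
  "equilibrium D R \<sigma> f \<longleftrightarrow>
     (\<forall>\<delta>\<zeta>. R *v \<delta>\<zeta> = 0 \<longrightarrow> (- (transpose D *v \<sigma>) + f) \<bullet> \<delta>\<zeta> = 0)"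

end

theory Submission
  imports Defs
begin

text \<open>Equilibrium says that \<open>f - D\<^sup>T \<sigma>\<close> is orthogonal to \<open>Ker R\<close>, i.e. lies in \<open>Im R\<^sup>T\<close>.
  Write \<open>B = (D\<^sup>T R\<^sup>T)\<close>. Whenever \<open>f\<close> lies in \<open>Im B\<close>, the Penrose identity \<open>B B\<^sup>+ B = B\<close>
  gives \<open>f = B B\<^sup>+ f = D\<^sup>T H f + R\<^sup>T g\<close> for some \<open>g\<close>, so \<open>f - D\<^sup>T H f \<in> Im R\<^sup>T\<close> as well, and
  subtracting the two shows that equilibrium is equivalent to \<open>D\<^sup>T (-\<sigma> + H f) \<in> Im R\<^sup>T\<close>.
  Equilibrium itself puts \<open>f = D\<^sup>T \<sigma> + R\<^sup>T y\<close> into \<open>Im B\<close>; full rank of \<open>B\<close> puts every \<open>f\<close>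
  there. Nothing about \<open>D\<close> being the Jacobian of the spring lengths is used.\<close>

lemma inner_transpose_mult_vector:
  fixes A :: "real^'n^'m"
  shows "(transpose A *v x) \<bullet> y = x \<bullet> (A *v y)"
  by (simp add: dot_lmul_matrix)

lemma inner_transpose_mult_self:
  fixes A :: "real^'n^'m"
  shows "x \<bullet> (transpose A *v (A *v x)) = (A *v x) \<bullet> (A *v x)"
  by (metis inner_commute inner_transpose_mult_vector)

lemma orthogonal_kernel_imp_in_range_transpose:
  fixes A :: "real^'n^'m"
  assumes "\<And>d. A *v d = 0 \<Longrightarrow> w \<bullet> d = 0"
  shows "w \<in> range ((*v) (transpose A))"
proof -
  let ?S = "range ((*v) (transpose A))"
  have "subspace ?S"
    by (rule linear_subspace_image[OF matrix_vector_mul_linear subspace_UNIV])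
  then have span_S: "span ?S = ?S"
    by simp
  obtain y z where "y \<in> span ?S" and z_orth: "\<And>u. u \<in> span ?S \<Longrightarrow> orthogonal z u"
    and w: "w = y + z"
    using orthogonal_subspace_decomp_exists[of ?S w] by blast
  have "orthogonal z (transpose A *v (A *v z))"
    by (rule z_orth) (use span_S in blast)
  then have "(A *v z) \<bullet> (A *v z) = 0"
    by (simp only: orthogonal_def inner_transpose_mult_self)
  then have "A *v z = 0"
    by simp
  then have "w \<bullet> z = 0"
    using assms by blast
  moreover have "y \<bullet> z = 0"
    using z_orth[OF \<open>y \<in> span ?S\<close>] by (simp add: orthogonal_def inner_commute)
  ultimately have "z = 0"
    using w by (simp add: inner_add_left)
  then show ?thesis
    using w \<open>y \<in> span ?S\<close> span_S by (metis add.right_neutral)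
qed

lemma transpose_mult_vector_in_range_gram:
  fixes A :: "real^'n^'m"
  shows "transpose A *v v \<in> range ((*v) (transpose A ** A))"
proof -
  have "(transpose A *v v) \<bullet> d = 0" if "(transpose A ** A) *v d = 0" for d
  proof -
    have "(A *v d) \<bullet> (A *v d) = 0"
      using that by (simp flip: inner_transpose_mult_self add: matrix_vector_mul_assoc)
    then have "A *v d = 0"
      by simp
    then show ?thesis
      by (metis inner_transpose_mult_vector inner_zero_right)
  qed
  then show ?thesis
    using orthogonal_kernel_imp_in_range_transpose[of "transpose A ** A"]
    by (simp add: matrix_transpose_mul)
qed

lemma matrix_mult_eq_solvable:
  fixes M :: "'a::comm_semiring_1^'n^'m" and N :: "'a^'k^'m"
  assumes "\<And>v. N *v v \<in> range ((*v) M)"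
  shows "\<exists>Y. M ** Y = N"
proof -
  from assms have "\<forall>j. \<exists>u. M *v u = N *v axis j 1"
    by (metis image_iff)
  then obtain u where u: "\<And>j. M *v u j = N *v axis j 1"
    by metis
  have "M ** transpose (\<chi> j. u j) = N"
  proof (rule vec_eq_iff[THEN iffD2], intro allI vec_eq_iff[THEN iffD2])
    fix i j
    have "(M ** transpose (\<chi> j. u j)) $ i $ j = (M *v u j) $ i"
      by (simp add: matrix_matrix_mult_def matrix_vector_mult_def transpose_def)
    also have "\<dots> = (N *v axis j 1) $ i"
      by (simp only: u)
    also have "\<dots> = N $ i $ j"
      by (simp add: matrix_vector_mult_def axis_def if_distrib cong: if_cong)
    finally show "(M ** transpose (\<chi> j. u j)) $ i $ j = N $ i $ j" .
  qed
  then show ?thesis ..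
qed

text \<open>Any solution \<open>Y\<close> of the normal equations \<open>A\<^sup>T A Y = A\<^sup>T\<close> will do.\<close>

lemma exists_generalized_inverse_symmetric:
  fixes A :: "real^'n^'m"
  shows "\<exists>Y. A ** Y ** A = A \<and> transpose (A ** Y) = A ** Y"
proof -
  obtain Y where "transpose A ** A ** Y = transpose A"
    using matrix_mult_eq_solvable transpose_mult_vector_in_range_gram by blast
  from arg_cong[OF this, of transpose] have YA: "transpose Y ** transpose A ** A = A"
    by (simp add: matrix_transpose_mul matrix_mul_assoc)
  then have sym: "transpose (A ** Y) = A ** Y"
    by (metis matrix_transpose_mul matrix_mul_assoc transpose_transpose)
  have "A ** Y ** A = transpose (A ** Y) ** A"
    by (simp only: sym)
  also have "\<dots> = A"
    using YA by (simp add: matrix_transpose_mul)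
  finally show ?thesis
    using sym by blast
qed

definition moore_penrose_inverse :: "real^'n^'m \<Rightarrow> real^'m^'n \<Rightarrow> bool" where
  "moore_penrose_inverse A X \<longleftrightarrow> A ** X ** A = A \<and> X ** A ** X = X \<and>
     transpose (A ** X) = A ** X \<and> transpose (X ** A) = X ** A"

lemma moore_penrose_inverse_exists:
  fixes A :: "real^'n^'m"
  shows "\<exists>X. moore_penrose_inverse A X"
proof -
  obtain Y where Y1: "A ** Y ** A = A" and Y2: "transpose (A ** Y) = A ** Y"
    using exists_generalized_inverse_symmetric by blast
  obtain W where W1: "transpose A ** W ** transpose A = transpose A"
    and W2: "transpose (transpose A ** W) = transpose A ** W"
    using exists_generalized_inverse_symmetric by blast
  define Z where "Z = transpose W"
  have Z1: "A ** Z ** A = A"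
    using arg_cong[OF W1, of transpose] by (simp add: Z_def matrix_transpose_mul matrix_mul_assoc)
  have Z2: "transpose (Z ** A) = Z ** A"
    using W2 by (simp add: Z_def matrix_transpose_mul)
  define X where "X = Z ** A ** Y"
  have AX: "A ** X = A ** Y"
    unfolding X_def using Z1 by (simp add: matrix_mul_assoc)
  have XA: "X ** A = Z ** A"
    unfolding X_def using Y1 by (simp flip: matrix_mul_assoc)
  have "X ** A ** X = Z ** (A ** X)"
    by (simp only: XA matrix_mul_assoc)
  also have "\<dots> = Z ** (A ** Y)"
    by (simp only: AX)
  also have "\<dots> = X"
    by (simp only: X_def matrix_mul_assoc)
  finally have "X ** A ** X = X" .
  then have "moore_penrose_inverse A X"
    unfolding moore_penrose_inverse_def AX XA using Y1 Y2 Z2 by simp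
  then show ?thesis ..
qed

lemma moore_penrose_inverse_unique:
  fixes A :: "real^'n^'m"
  assumes "moore_penrose_inverse A X" and "moore_penrose_inverse A X'"
  shows "X = X'"
proof -
  from assms have a1: "A ** X ** A = A" and a2: "X ** A ** X = X"
    and a3: "transpose (A ** X) = A ** X" and a4: "transpose (X ** A) = X ** A"
    and b1: "A ** X' ** A = A" and b2: "X' ** A ** X' = X'"
    and b3: "transpose (A ** X') = A ** X'" and b4: "transpose (X' ** A) = X' ** A"
    unfolding moore_penrose_inverse_def by blast+
  have AX: "A ** X = A ** X'"
  proof -
    have "A ** X = transpose (A ** X' ** A ** X)"
      by (simp only: a3 b1)
    also have "\<dots> = transpose (A ** X) ** transpose (A ** X')"
      by (simp add: matrix_transpose_mul matrix_mul_assoc)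
    also have "\<dots> = A ** X'"
      by (simp only: a3 b3 matrix_mul_assoc a1)
    finally show ?thesis .
  qed
  have XA: "X ** A = X' ** A"
  proof -
    have "X ** A = transpose (X ** A ** X' ** A)"
      using b1 by (simp add: a4 flip: matrix_mul_assoc)
    also have "\<dots> = transpose (X' ** A) ** transpose (X ** A)"
      by (simp add: matrix_transpose_mul matrix_mul_assoc)
    also have "\<dots> = X' ** A"
      using a1 by (simp add: a4 b4 flip: matrix_mul_assoc)
    finally show ?thesis .
  qed
  have "X = X' ** A ** X"
    by (simp only: a2 flip: XA)
  also have "\<dots> = X' ** (A ** X')"
    by (simp only: AX flip: matrix_mul_assoc)
  also have "\<dots> = X'"
    by (simp only: b2 matrix_mul_assoc)
  finally show ?thesis .
qed

lemma moore_penrose_inverse_pinv: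
  fixes A :: "real^'n^'m"
  shows "moore_penrose_inverse A (pinv A)"
proof -
  have "\<exists>!X. moore_penrose_inverse A X"
    using moore_penrose_inverse_exists moore_penrose_inverse_unique by blast
  then show ?thesis
    unfolding pinv_def moore_penrose_inverse_def[symmetric] by (rule theI')
qed

lemma sum_UNIV_Plus:
  "sum g (UNIV :: ('a::finite + 'b::finite) set) = (\<Sum>i\<in>UNIV. g (Inl i)) + (\<Sum>l\<in>UNIV. g (Inr l))"
  using sum.Plus[of UNIV UNIV g] by (simp add: comp_def)

lemma block_DR_mult_vector:
  "block_DR D R *v z = transpose D *v (\<chi> i. z $ Inl i) + transpose R *v (\<chi> l. z $ Inr l)"
  by (simp add: vec_eq_iff matrix_vector_mult_def block_DR_def transpose_def sum_UNIV_Plus)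

lemma Hmat_mult_vector: "Hmat D R *v f = (\<chi> i. (pinv (block_DR D R) *v f) $ Inl i)"
  by (simp add: vec_eq_iff matrix_vector_mult_def Hmat_def)

lemma equilibrium_iff_in_range_transpose:
  "equilibrium D R \<sigma> f \<longleftrightarrow> f - transpose D *v \<sigma> \<in> range ((*v) (transpose R))"
proof
  assume "equilibrium D R \<sigma> f"
  then have "(f - transpose D *v \<sigma>) \<bullet> d = 0" if "R *v d = 0" for d
    using that unfolding equilibrium_def by simp
  then show "f - transpose D *v \<sigma> \<in> range ((*v) (transpose R))"
    by (rule orthogonal_kernel_imp_in_range_transpose)
next
  assume "f - transpose D *v \<sigma> \<in> range ((*v) (transpose R))"
  then obtain y where y: "- (transpose D *v \<sigma>) + f = transpose R *v y"
    by auto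
  show "equilibrium D R \<sigma> f"
    unfolding equilibrium_def y by (metis inner_transpose_mult_vector inner_zero_right)
qed

lemma equilibrium_imp_in_range_block_DR:
  assumes "equilibrium D R \<sigma> f"
  shows "f \<in> range ((*v) (block_DR D R))"
proof -
  obtain y where "f - transpose D *v \<sigma> = transpose R *v y"
    using assms equilibrium_iff_in_range_transpose by blast
  then have "f = block_DR D R *v (\<chi> c. case c of Inl i \<Rightarrow> \<sigma> $ i | Inr l \<Rightarrow> y $ l)"
    by (simp add: block_DR_mult_vector algebra_simps)
  then show ?thesis
    by (rule range_eqI)
qed

lemma Hmat_residual_in_range_transpose:
  assumes "f \<in> range ((*v) (block_DR D R))"
  shows "f - transpose D *v (Hmat D R *v f) \<in> range ((*v) (transpose R))"
proof -
  let ?B = "block_DR D R"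
  obtain z where f: "f = ?B *v z"
    using assms by blast
  have "f = (?B ** pinv ?B ** ?B) *v z"
    using moore_penrose_inverse_pinv[of ?B] by (simp add: f moore_penrose_inverse_def)
  also have "\<dots> = ?B *v (pinv ?B *v f)"
    by (simp add: f matrix_vector_mul_assoc matrix_mul_assoc)
  also have "\<dots> = transpose D *v (Hmat D R *v f) + transpose R *v (\<chi> l. (pinv ?B *v f) $ Inr l)"
    by (simp only: block_DR_mult_vector Hmat_mult_vector)
  finally have "f = transpose D *v (Hmat D R *v f) + transpose R *v (\<chi> l. (pinv ?B *v f) $ Inr l)" .
  then have "f - transpose D *v (Hmat D R *v f) = transpose R *v (\<chi> l. (pinv ?B *v f) $ Inr l)"
    by (simp add: algebra_simps)
  then show ?thesis
    by (rule range_eqI)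
qed

lemma equilibrium_iff_Hmat:
  assumes "f \<in> range ((*v) (block_DR D R))"
  shows "equilibrium D R \<sigma> f \<longleftrightarrow>
    transpose D *v (- \<sigma> + Hmat D R *v f) \<in> range ((*v) (transpose R))"
proof -
  let ?V = "range ((*v) (transpose R))"
  let ?a = "transpose D *v (- \<sigma> + Hmat D R *v f)"
  let ?r = "f - transpose D *v (Hmat D R *v f)"
  have V: "subspace ?V"
    by (rule linear_subspace_image[OF matrix_vector_mul_linear subspace_UNIV])
  have r: "?r \<in> ?V"
    using Hmat_residual_in_range_transpose[OF assms] .
  have decomp: "f - transpose D *v \<sigma> = ?a + ?r"
    using matrix_vector_mult_diff_distrib[of "transpose D" "Hmat D R *v f" \<sigma>]
    by (simp add: algebra_simps)
  show ?thesis
    unfolding equilibrium_iff_in_range_transpose decomp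
  proof
    assume "?a + ?r \<in> ?V"
    then have "?a + ?r - ?r \<in> ?V"
      using r by (rule subspace_diff[OF V])
    then show "?a \<in> ?V"
      by (simp only: add_diff_cancel_right')
  next
    assume "?a \<in> ?V"
    then show "?a + ?r \<in> ?V"
      using r by (rule subspace_add[OF V])
  qed
qed

theorem proposition6:
  fixes Q :: "real^'s::finite^'node::finite"
    and \<xi>0 :: "real^('node \<times> 'dim::finite)"
    and R :: "real^('node \<times> 'dim)^'q::finite"
    and \<sigma> :: "real^'s"
  assumes "incidence_matrix Q"
    and "\<forall>i. spring_length Q \<xi>0 i \<noteq> 0"
  shows "(\<forall>f. equilibrium (Dphi Q \<xi>0) R \<sigma> f \<longrightarrow>
            transpose (Dphi Q \<xi>0) *v (- \<sigma> + Hmat (Dphi Q \<xi>0) R *v f)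
              \<in> range (\<lambda>y. transpose R *v y))
       \<and> (rank (block_DR (Dphi Q \<xi>0) R) = CARD('node \<times> 'dim) \<longrightarrow>
           (\<forall>f. transpose (Dphi Q \<xi>0) *v (- \<sigma> + Hmat (Dphi Q \<xi>0) R *v f)
                  \<in> range (\<lambda>y. transpose R *v y)
                \<longrightarrow> equilibrium (Dphi Q \<xi>0) R \<sigma> f))"
proof (intro conjI allI impI)
  let ?D = "Dphi Q \<xi>0"
  fix f
  assume eq: "equilibrium ?D R \<sigma> f"
  show "transpose ?D *v (- \<sigma> + Hmat ?D R *v f) \<in> range (\<lambda>y. transpose R *v y)"
    using equilibrium_iff_Hmat[OF equilibrium_imp_in_range_block_DR[OF eq]] eq ..
next
  let ?D = "Dphi Q \<xi>0"
  fix f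
  assume "rank (block_DR ?D R) = CARD('node \<times> 'dim)"
  then have "surj ((*v) (block_DR ?D R))"
    using full_rank_surjective by blast
  then have "f \<in> range ((*v) (block_DR ?D R))"
    by simp
  moreover assume "transpose ?D *v (- \<sigma> + Hmat ?D R *v f) \<in> range (\<lambda>y. transpose R *v y)"
  ultimately show "equilibrium ?D R \<sigma> f"
    using equilibrium_iff_Hmat by blast
qed

end
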